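(* For every integer $k\ge 2$, the subdivision $K_k^{\mathrm{div}}$ of the complete graph $K_k$ is a non-trivial square.
   Context: All graphs are finite, simple, without loops. For a graph $H$, $H^{\mathrm{div}}$ is the graph obtained from $H$ by replacing every edge by a path of length two (adding one new vertex per edge). A partially labeled graph is a graph in which some (possibly none, possibly all) vertices carry labels from $\mathbb{N}=\{1,2,3,\dots\}$, no two vertices having the same label and no vertex having more than one label. The product $F_1F_2$ of two partially labeled graphs is obtained by taking their disjoint union, gluing together vertices with the same label, and keeping only one copy of any doubled edge; $F^2=FF$. For a partially labeled graph $F$, $[[F]]$ is the unlabeled graph obtained by removing all labels. Equality of unlabeled graphs means isomorphism. An unlabeled graph $H$ is a trivial square if whenever $H=[[F^2]]$ for a partially labeled graph $F$, then $F$ is a fully labeled copy of $H$. Otherwise $H$ is a non-trivial square. *)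

theory Defs
  imports "Graph_Theory.Graph_Theory"
begin

text \<open>
  A finite simple graph is a \<^const>\<open>pair_graph\<close>: a finite loop-free symmetric digraph whose arcs are
  pairs of vertices, every edge being present as its two opposite arcs. Between such graphs,
  \<^const>\<open>digraph_iso\<close> is ordinary graph isomorphism.
\<close>

abbreviation graph_iso :: "'a pair_pre_digraph \<Rightarrow> 'b pair_pre_digraph \<Rightarrow> bool" where
  "graph_iso G H \<equiv> digraph_iso (with_proj G) (with_proj H)"

text \<open>
  The new vertex on the edge between \<open>u\<close> and \<open>v\<close> is \<open>Inr {u, v}\<close>. As \<open>G\<close> is symmetric, the arcs
  \<open>(u, v)\<close> and \<open>(v, u)\<close> together contribute both halves of the path of length two.
\<close>

definition div_graph :: "'a pair_pre_digraph \<Rightarrow> ('a + 'a set) pair_pre_digraph" where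
  "div_graph G = \<lparr>
     pverts = Inl ` pverts G \<union> {Inr {u, v} | u v. (u, v) \<in> parcs G},
     parcs = {(Inl u, Inr {u, v}) | u v. (u, v) \<in> parcs G}
           \<union> {(Inr {u, v}, Inl u) | u v. (u, v) \<in> parcs G} \<rparr>"

text \<open>The field \<open>unlabel\<close> is the unlabeled graph \<open>[[F]]\<close>; \<open>None\<close> marks an unlabeled vertex.\<close>

record 'a plgraph =
  unlabel :: "'a pair_pre_digraph"
  label :: "'a \<rightharpoonup> nat"

definition partially_labeled_graph :: "'a plgraph \<Rightarrow> bool" where
  "partially_labeled_graph F \<longleftrightarrow>
     pair_graph (unlabel F) \<and>
     dom (label F) \<subseteq> pverts (unlabel F) \<and>
     inj_on (label F) (dom (label F)) \<and>
     0 \<notin> ran (label F)"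

definition disjoint_union :: "'a pair_pre_digraph \<Rightarrow> 'b pair_pre_digraph \<Rightarrow> ('a + 'b) pair_pre_digraph" where
  "disjoint_union G H = \<lparr>
     pverts = pverts G <+> pverts H,
     parcs = map_prod Inl Inl ` parcs G \<union> map_prod Inr Inr ` parcs H \<rparr>"

definition glue_rel :: "'a plgraph \<Rightarrow> 'b plgraph \<Rightarrow> ('a + 'b) rel" where
  "glue_rel F1 F2 =
     (let V = pverts (disjoint_union (unlabel F1) (unlabel F2));
          l = case_sum (label F1) (label F2)
      in {(x, y) \<in> V \<times> V. x = y \<or> (l x \<noteq> None \<and> l x = l y)})"

text \<open>
  The product is the quotient of the disjoint union by \<open>glue_rel\<close>. Its arcs form a set, so a doubled
  edge is automatically kept only once. All members of a class carry the same label, so the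
  choice of representative in the labeling is immaterial.
\<close>

definition plgraph_prod :: "'a plgraph \<Rightarrow> 'b plgraph \<Rightarrow> ('a + 'b) set plgraph" where
  "plgraph_prod F1 F2 =
     (let D = disjoint_union (unlabel F1) (unlabel F2);
          R = glue_rel F1 F2
      in \<lparr> unlabel = \<lparr> pverts = pverts D // R,
                       parcs = {(R `` {x}, R `` {y}) | x y. (x, y) \<in> parcs D} \<rparr>,
           label = (\<lambda>C. if C \<in> pverts D // R
                        then case_sum (label F1) (label F2) (SOME x. x \<in> C) else None) \<rparr>)"

abbreviation plgraph_square :: "'a plgraph \<Rightarrow> ('a + 'a) set plgraph" where
  "plgraph_square F \<equiv> plgraph_prod F F"

definition fully_labeled_copy :: "'a plgraph \<Rightarrow> 'b pair_pre_digraph \<Rightarrow> bool" where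
  "fully_labeled_copy F H \<longleftrightarrow>
     dom (label F) = pverts (unlabel F) \<and> graph_iso (unlabel F) H"

text \<open>
  Letting \<open>F\<close> range over graphs with natural numbers as vertices loses no generality: every finite
  graph has an isomorphic copy of this kind.
\<close>

definition trivial_square :: "'a pair_pre_digraph \<Rightarrow> bool" where
  "trivial_square H \<longleftrightarrow>
     (\<forall>F :: nat plgraph. partially_labeled_graph F \<and> graph_iso H (unlabel (plgraph_square F))
        \<longrightarrow> fully_labeled_copy F H)"

definition nontrivial_square :: "'a pair_pre_digraph \<Rightarrow> bool" where
  "nontrivial_square H \<longleftrightarrow> \<not> trivial_square H"

lemma pair_graph_div_graph:
  assumes "pair_graph G"
  shows "pair_graph (div_graph G)"
proof -
  interpret pair_graph G by fact
  have "{Inr {u, v} | u v. (u, v) \<in> parcs G} = (\<lambda>(u, v). Inr {u, v}) ` parcs G"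
    "{(Inl u, Inr {u, v}) | u v. (u, v) \<in> parcs G} = (\<lambda>(u, v). (Inl u, Inr {u, v})) ` parcs G"
    "{(Inr {u, v}, Inl u) | u v. (u, v) \<in> parcs G} = (\<lambda>(u, v). (Inr {u, v}, Inl u)) ` parcs G"
    by auto
  note fin = this
  show ?thesis
  proof unfold_locales
    show "finite (pverts (div_graph G))" "finite (parcs (div_graph G))"
      using pair_finite_verts pair_finite_arcs by (simp_all add: div_graph_def fin)
    show "symmetric (div_graph G)"
      by (auto simp: symmetric_def div_graph_def sym_def)
  qed (auto simp: div_graph_def dest: wellformed')
qed

lemma equiv_glue_rel:
  "equiv (pverts (disjoint_union (unlabel F1) (unlabel F2))) (glue_rel F1 F2)"
  unfolding equiv_def refl_on_def sym_def trans_def glue_rel_def Let_def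
  by (simp del: not_None_eq) (blast intro: sym trans)

lemma pair_graph_disjoint_union:
  assumes "pair_graph G" "pair_graph H"
  shows "pair_graph (disjoint_union G H)"
proof -
  interpret G: pair_graph G by fact
  interpret H: pair_graph H by fact
  show ?thesis
  proof unfold_locales
    show "symmetric (disjoint_union G H)"
      using G.arcs_symmetric H.arcs_symmetric
      by (force simp: symmetric_def disjoint_union_def sym_def image_iff)
  qed (use G.no_loops' H.no_loops' in
        \<open>auto simp: disjoint_union_def dest: G.wellformed' H.wellformed'\<close>)
qed

lemma partially_labeled_graph_plgraph_prod:
  assumes F1: "partially_labeled_graph F1" and F2: "partially_labeled_graph F2"
  shows "partially_labeled_graph (plgraph_prod F1 F2)"
proof -
  define D where "D = disjoint_union (unlabel F1) (unlabel F2)"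
  define R where "R = glue_rel F1 F2"
  define l where "l = case_sum (label F1) (label F2)"
  have P: "plgraph_prod F1 F2 = \<lparr> unlabel = \<lparr> pverts = pverts D // R,
      parcs = {(R `` {x}, R `` {y}) | x y. (x, y) \<in> parcs D} \<rparr>,
      label = (\<lambda>C. if C \<in> pverts D // R then l (SOME x. x \<in> C) else None) \<rparr>"
    unfolding plgraph_prod_def D_def R_def l_def Let_def by (rule refl)
  interpret D: pair_graph D
    unfolding D_def using F1 F2
    by (intro pair_graph_disjoint_union) (simp_all add: partially_labeled_graph_def)
  have eq: "equiv (pverts D) R" unfolding D_def R_def by (rule equiv_glue_rel)
  have R_iff: "(x, y) \<in> R \<longleftrightarrow> x \<in> pverts D \<and> y \<in> pverts D \<and> (x = y \<or> l x \<noteq> None \<and> l x = l y)" for x y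
    by (simp add: R_def D_def l_def glue_rel_def Let_def)
  have arc_label: "l x \<noteq> l y \<or> l x = None" if "(x, y) \<in> parcs D" for x y
  proof -
    have "x \<noteq> y" using that D.no_loops' by blast
    moreover have "a = b" if "label F1 a = Some c" "label F1 b = Some c" for a b c
      using F1 that by (auto simp: partially_labeled_graph_def dest!: inj_onD[of _ _ a b])
    moreover have "a = b" if "label F2 a = Some c" "label F2 b = Some c" for a b c
      using F2 that by (auto simp: partially_labeled_graph_def dest!: inj_onD[of _ _ a b])
    ultimately show ?thesis using that
      by (auto simp: D_def disjoint_union_def l_def)
  qed
  have fin: "{(R `` {x}, R `` {y}) | x y. (x, y) \<in> parcs D}
      = (\<lambda>(x, y). (R `` {x}, R `` {y})) ` parcs D"
    by auto
  have "pair_graph (unlabel (plgraph_prod F1 F2))"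
  proof unfold_locales
    show "finite (pverts (unlabel (plgraph_prod F1 F2)))"
      using D.pair_finite_verts by (simp add: P quotient_def)
    show "finite (parcs (unlabel (plgraph_prod F1 F2)))"
      using D.pair_finite_arcs by (simp add: P fin)
    show "symmetric (unlabel (plgraph_prod F1 F2))"
      using D.arcs_symmetric by (simp add: P symmetric_def sym_def) blast
    show "fst e \<noteq> snd e" if e: "e \<in> parcs (unlabel (plgraph_prod F1 F2))" for e
    proof -
      obtain x y where xy: "e = (R `` {x}, R `` {y})" "(x, y) \<in> parcs D"
        using e by (auto simp: P)
      have "(x, y) \<notin> R"
        using arc_label[OF xy(2)] D.no_loops'[OF xy(2)] by (auto simp: R_iff)
      then show ?thesis
        using xy eq_equiv_class[OF _ eq] D.wellformed'[OF xy(2)] by auto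
    qed
  qed (auto simp: P intro!: quotientI dest: D.wellformed')
  moreover have ex: "\<exists>z \<in> pverts D. C = R `` {z} \<and> l (SOME x. x \<in> C) = l z"
    if C: "C \<in> pverts D // R" for C
  proof -
    obtain z where z: "z \<in> pverts D" "C = R `` {z}" using C by (rule quotientE)
    have "z \<in> C" using equiv_class_self[OF eq z(1)] z(2) by simp
    then have "(SOME x. x \<in> C) \<in> C" by (rule someI)
    then have "(z, SOME x. x \<in> C) \<in> R" unfolding z(2) by simp
    then have "l (SOME x. x \<in> C) = l z" unfolding R_iff by metis
    then show ?thesis using z by blast
  qed
  have "inj_on (label (plgraph_prod F1 F2)) (dom (label (plgraph_prod F1 F2)))"
  proof (rule inj_onI)
    fix A B
    assume A: "A \<in> dom (label (plgraph_prod F1 F2))" and B: "B \<in> dom (label (plgraph_prod F1 F2))"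
      and AB: "label (plgraph_prod F1 F2) A = label (plgraph_prod F1 F2) B"
    have A': "A \<in> pverts D // R" and B': "B \<in> pverts D // R"
      using A B by (auto simp: P split: if_splits)
    obtain a where a: "a \<in> pverts D" "A = R `` {a}" "l (SOME x. x \<in> A) = l a" using ex[OF A'] by blast
    obtain b where b: "b \<in> pverts D" "B = R `` {b}" "l (SOME x. x \<in> B) = l b" using ex[OF B'] by blast
    have "l a = l b" "l a \<noteq> None"
      using A AB A' B' a(3) b(3) by (auto simp: P)
    then have "(a, b) \<in> R" using a b by (simp add: R_iff)
    then show "A = B" using a b equiv_class_eq[OF eq] by simp
  qed
  moreover have "0 \<notin> ran (label (plgraph_prod F1 F2))"
  proof
    assume "0 \<in> ran (label (plgraph_prod F1 F2))"
    then obtain C where C: "C \<in> pverts D // R" "l (SOME x. x \<in> C) = Some 0"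
      by (auto simp: P ran_def split: if_splits)
    obtain z where "l z = Some 0" using ex[OF C(1)] C(2) by auto
    then show False using F1 F2
      by (cases z) (auto simp: l_def partially_labeled_graph_def ran_def)
  qed
  moreover have "dom (label (plgraph_prod F1 F2)) \<subseteq> pverts (unlabel (plgraph_prod F1 F2))"
    by (auto simp: P split: if_splits)
  ultimately show ?thesis
    by (simp add: partially_labeled_graph_def)
qed

end

theory Submission
  imports Defs "HOL-Combinatorics.Transposition"
begin

text \<open>
  A mirror symmetry exhibits a graph as a square. Suppose an involutive automorphism \<open>\<sigma>\<close> of \<open>H\<close>
  splits the vertices that it moves into two halves \<open>A\<close> and \<open>\<sigma> A\<close> without an edge from one half to
  the other. Take for \<open>F\<close> the subgraph induced by \<open>A\<close> together with the fixed vertices, with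
  labels on exactly the fixed vertices. In \<open>F\<^sup>2\<close> the two copies of \<open>F\<close> are glued along the fixed
  vertices; the first copy becomes \<open>A\<close> with the mirror, the second one, read through \<open>\<sigma>\<close>, becomes
  \<open>\<sigma> A\<close> with the mirror. No edge of \<open>H\<close> is lost, because each lies in one of the two sides. So
  \<open>[[F\<^sup>2]] = H\<close>, and \<open>F\<close> is not fully labeled as soon as \<open>A\<close> is non-empty
  (\<open>nontrivial_square_if_mirror\<close>).

  Any two vertices \<open>a\<close> and \<open>b\<close> of a complete graph are twins: exchanging them is an automorphism.
  On the subdivision, this exchange moves only \<open>a\<close>, \<open>b\<close> and the midpoints of the edges joining one
  of them to a third vertex \<open>c\<close>. The midpoint of the edge \<open>ab\<close> itself stays fixed, and subdividing
  has put it between \<open>a\<close> and \<open>b\<close>. Hence \<open>a\<close> with the midpoints of its edges \<open>ac\<close> is one half of a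
  mirror, and \<open>b\<close> with the midpoints of its edges \<open>bc\<close> is the other
  (\<open>nontrivial_square_div_graph_if_twins\<close>).
\<close>

lemma graph_isoI:
  assumes "pair_wf_digraph G" and "inj_on h (pverts G)"
    and "pverts H = h ` pverts G" and "parcs H = map_prod h h ` parcs G"
  shows "graph_iso G H"
proof -
  interpret pair_wf_digraph G by fact
  let ?f = "\<lparr>iso_verts = h, iso_arcs = map_prod h h, iso_head = snd, iso_tail = fst\<rparr>"
  have "inj_on (map_prod h h) (parcs G)"
    using map_prod_inj_on[OF assms(2) assms(2)]
    by (rule inj_on_subset) (auto dest: wellformed')
  then have "pre_digraph.digraph_isomorphism (with_proj G) ?f"
    using assms(1,2) by (auto simp: pre_digraph.digraph_isomorphism_def wf_digraph_wp_iff)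
  moreover have "with_proj H = app_iso ?f (with_proj G)"
    using assms(3,4) by (simp add: with_proj_def app_iso_def)
  ultimately show ?thesis unfolding digraph_iso_def by blast
qed

text \<open>
  This is the first isomorphism theorem for the product: a map of the disjoint union onto \<open>H\<close>, on
  vertices and on arcs, which identifies precisely the vertices that are glued, factors through the
  quotient. It removes equivalence classes from all later arguments.
\<close>

lemma graph_iso_plgraph_prodI:
  fixes F1 :: "'a plgraph" and F2 :: "'b plgraph"
  defines "D \<equiv> disjoint_union (unlabel F1) (unlabel F2)"
  assumes D: "pair_wf_digraph D" and H: "pair_wf_digraph H"
    and verts: "p ` pverts D = pverts H"
    and arcs: "map_prod p p ` parcs D = parcs H"
    and kernel: "\<And>x y. x \<in> pverts D \<Longrightarrow> y \<in> pverts D \<Longrightarrow> (x, y) \<in> glue_rel F1 F2 \<longleftrightarrow> p x = p y"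
  shows "graph_iso H (unlabel (plgraph_prod F1 F2))"
proof -
  interpret D: pair_wf_digraph D by fact
  define h where "h y = {x \<in> pverts D. p x = y}" for y
  have "glue_rel F1 F2 \<subseteq> pverts D \<times> pverts D"
    by (auto simp: D_def glue_rel_def Let_def)
  then have fibre: "glue_rel F1 F2 `` {x} = h (p x)" if "x \<in> pverts D" for x
    using kernel[OF that] by (auto simp: h_def)
  have "inj_on h (pverts H)"
    unfolding verts[symmetric] by (rule inj_onI) (auto simp: h_def)
  moreover have "pverts (unlabel (plgraph_prod F1 F2)) = h ` pverts H"
  proof -
    have "pverts (unlabel (plgraph_prod F1 F2)) = (\<lambda>x. glue_rel F1 F2 `` {x}) ` pverts D"
      by (auto simp: plgraph_prod_def Let_def D_def quotient_def)
    also have "\<dots> = h ` p ` pverts D"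
      by (simp add: fibre image_image)
    finally show ?thesis by (simp add: verts)
  qed
  moreover have "parcs (unlabel (plgraph_prod F1 F2)) = map_prod h h ` parcs H"
  proof -
    have "parcs (unlabel (plgraph_prod F1 F2))
        = (\<lambda>(x, y). (glue_rel F1 F2 `` {x}, glue_rel F1 F2 `` {y})) ` parcs D"
      by (auto simp: plgraph_prod_def Let_def D_def)
    also have "\<dots> = (\<lambda>(x, y). (h (p x), h (p y))) ` parcs D"
      using fibre D.arc_fst_in_verts D.arc_snd_in_verts
      by (intro image_cong) (simp_all add: case_prod_unfold)
    also have "\<dots> = map_prod h h ` map_prod p p ` parcs D"
      by (simp add: image_image map_prod_def case_prod_unfold)
    finally show ?thesis by (simp add: arcs)
  qed
  ultimately show ?thesis by (intro graph_isoI H)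
qed

text \<open>
  Since \<open>\<sigma>\<close> is an involution, \<open>\<sigma> y \<in> A\<close> says that \<open>y\<close> lies in the half \<open>\<sigma> A\<close>; the last assumption
  thus forbids edges between the halves. Such an edge would be lost in the product, which joins
  vertices of different copies of \<open>F\<close> only through labeled ones.
\<close>

lemma nontrivial_square_if_mirror:
  assumes H: "pair_graph H"
    and closed: "\<And>x. x \<in> pverts H \<Longrightarrow> \<sigma> x \<in> pverts H"
    and invol: "\<And>x. x \<in> pverts H \<Longrightarrow> \<sigma> (\<sigma> x) = x"
    and autom: "\<And>x y. (x, y) \<in> parcs H \<Longrightarrow> (\<sigma> x, \<sigma> y) \<in> parcs H"
    and A: "A \<subseteq> pverts H" "A \<noteq> {}" "A \<inter> \<sigma> ` A = {}"
    and cover: "\<And>x. x \<in> pverts H \<Longrightarrow> \<sigma> x = x \<or> x \<in> A \<or> \<sigma> x \<in> A"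
    and separated: "\<And>x y. (x, y) \<in> parcs H \<Longrightarrow> x \<in> A \<Longrightarrow> \<sigma> y \<notin> A"
  shows "nontrivial_square H"
proof -
  interpret H: pair_graph H by fact
  define S where "S = {x \<in> pverts H. \<sigma> x = x}"
  define B where "B = S \<union> A"
  have B: "B \<subseteq> pverts H" using A by (auto simp: B_def S_def)
  have "finite B" using B H.pair_finite_verts by (rule finite_subset)
  then obtain g where g: "bij_betw g {0..<card B} B"
    using ex_bij_betw_nat_finite by blast
  define W where "W = {0..<card B}"
  have inj: "g i = g j \<longleftrightarrow> i = j" if "i \<in> W" "j \<in> W" for i j
    using g that by (auto simp: W_def bij_betw_def inj_on_def)
  have im: "g ` W = B" using g by (simp add: W_def bij_betw_def)
  then have gB: "g i \<in> B" if "i \<in> W" for i using that by blast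
  \<comment> \<open>Labels are positive, hence the successor.\<close>
  define F where "F = \<lparr> unlabel = \<lparr> pverts = W, parcs = {(i, j) \<in> W \<times> W. (g i, g j) \<in> parcs H} \<rparr>,
    label = (\<lambda>i. if i \<in> W \<and> \<sigma> (g i) = g i then Some (Suc i) else None) \<rparr>"
  define D where "D = disjoint_union (unlabel F) (unlabel F)"
  \<comment> \<open>The first copy of \<open>F\<close> is put in place directly, the second one as its mirror image.\<close>
  define p where "p = case_sum g (\<sigma> \<circ> g)"
  have F_graph: "pair_graph (unlabel F)"
  proof unfold_locales
    have "parcs (unlabel F) \<subseteq> W \<times> W" by (auto simp: F_def)
    then show "finite (parcs (unlabel F))" by (rule finite_subset) (simp add: W_def)
    show "symmetric (unlabel F)"
      using H.arcs_symmetric by (auto simp: F_def symmetric_def sym_def)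
  qed (auto simp: F_def W_def dest: H.no_loops')
  have F: "partially_labeled_graph F"
    unfolding partially_labeled_graph_def using F_graph
    by (auto simp: F_def inj_on_def ran_def split: if_splits)
  have "pair_graph D" unfolding D_def by (intro pair_graph_disjoint_union F_graph)
  then interpret D: pair_graph D .
  have verts: "p ` pverts D = pverts H"
  proof -
    have "p ` pverts D = g ` W \<union> \<sigma> ` g ` W"
      by (simp add: p_def D_def F_def disjoint_union_def Plus_def image_Un image_image)
    also have "\<dots> = B \<union> \<sigma> ` B" by (simp add: im)
    also have "\<dots> = pverts H"
    proof
      show "B \<union> \<sigma> ` B \<subseteq> pverts H" using B closed by blast
      show "pverts H \<subseteq> B \<union> \<sigma> ` B"
      proof
        fix x assume x: "x \<in> pverts H"
        have "x \<in> \<sigma> ` B" if "\<sigma> x \<in> A"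
          using that invol[OF x] unfolding B_def by (metis UnI2 imageI)
        then show "x \<in> B \<union> \<sigma> ` B" using cover[OF x] x by (auto simp: B_def S_def)
      qed
    qed
    finally show ?thesis .
  qed
  have arcs: "map_prod p p ` parcs D = parcs H"
  proof
    show "map_prod p p ` parcs D \<subseteq> parcs H"
      using autom by (auto simp: p_def D_def F_def disjoint_union_def)
    show "parcs H \<subseteq> map_prod p p ` parcs D"
    proof
      fix e assume "e \<in> parcs H"
      then obtain x y where e: "e = (x, y)" "(x, y) \<in> parcs H" by (cases e) auto
      have x: "x \<in> pverts H" and y: "y \<in> pverts H" using H.wellformed' e(2) by blast+
      have "(y, x) \<in> parcs H" using e(2) H.arcs_symmetric by (auto simp: sym_def)
      \<comment> \<open>By separation, no edge crosses the mirror, so both ends lie on a common side.\<close>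
      then consider "x \<in> B" "y \<in> B" | "\<sigma> x \<in> B" "\<sigma> y \<in> B"
        using cover[OF x] cover[OF y] separated[of x y] separated[of y x] e(2) x y
        by (auto simp: B_def S_def)
      then show "e \<in> map_prod p p ` parcs D"
      proof cases
        case 1
        then obtain i j where ij: "i \<in> W" "j \<in> W" "x = g i" "y = g j" using im by blast
        then have "(Inl i, Inl j) \<in> parcs D"
          using e(2) by (force simp: D_def F_def disjoint_union_def)
        then show ?thesis using ij e(1) by (force simp: p_def)
      next
        case 2
        then obtain i j where ij: "i \<in> W" "j \<in> W" "\<sigma> x = g i" "\<sigma> y = g j" using im by blast
        then have "(Inr i, Inr j) \<in> parcs D"
          using autom[OF e(2)] by (force simp: D_def F_def disjoint_union_def)
        moreover have "p (Inr i) = x" "p (Inr j) = y"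
          using ij invol x y by (auto simp: p_def simp flip: ij(3,4))
        ultimately show ?thesis using e(1) by force
      qed
    qed
  qed
  \<comment> \<open>The two sides meet only in the mirror.\<close>
  have meet: "x = y \<and> \<sigma> y = y" if "x \<in> B" "y \<in> B" "x = \<sigma> y" for x y
    using that A(3) B invol by (auto simp: B_def S_def)
  have kernel: "(u, v) \<in> glue_rel F F \<longleftrightarrow> p u = p v" if uv: "u \<in> pverts D" "v \<in> pverts D" for u v
  proof -
    have glue: "(u, v) \<in> glue_rel F F \<longleftrightarrow> u = v \<or>
        (case_sum (label F) (label F) u \<noteq> None \<and>
         case_sum (label F) (label F) u = case_sum (label F) (label F) v)"
      using uv by (simp add: glue_rel_def D_def Let_def)
    have label_F: "label F i = (if \<sigma> (g i) = g i then Some (Suc i) else None)" if "i \<in> W" for i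
      using that by (simp add: F_def)
    have inj': "\<sigma> (g i) = \<sigma> (g j) \<longleftrightarrow> i = j" if "i \<in> W" "j \<in> W" for i j
      using inj[OF that] invol gB[OF that(1)] gB[OF that(2)] B by (metis subsetD)
    consider i j where "u = Inl i" "v = Inl j" "i \<in> W" "j \<in> W"
      | i j where "u = Inr i" "v = Inr j" "i \<in> W" "j \<in> W"
      | i j where "u = Inl i" "v = Inr j" "i \<in> W" "j \<in> W"
      | i j where "u = Inr i" "v = Inl j" "i \<in> W" "j \<in> W"
      using uv by (auto simp: D_def F_def disjoint_union_def)
    then show ?thesis
    proof cases
      case 1 then show ?thesis unfolding glue by (auto simp: p_def label_F inj)
    next
      case 2 then show ?thesis unfolding glue by (auto simp: p_def label_F inj')
    next
      case 3 then show ?thesis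
        using meet[OF gB[of i] gB[of j]] inj[of i j] unfolding glue by (auto simp: p_def label_F)
    next
      case 4 then show ?thesis
        using meet[OF gB[of j] gB[of i]] inj[of i j] unfolding glue by (auto simp: p_def label_F)
    qed
  qed
  have "graph_iso H (unlabel (plgraph_square F))"
    by (rule graph_iso_plgraph_prodI[of F F H p])
      (use verts arcs kernel D.pair_wf_digraph H.pair_wf_digraph in \<open>simp_all add: D_def\<close>)
  moreover have "dom (label F) \<noteq> pverts (unlabel F)"
  proof -
    obtain x where x: "x \<in> A" using A(2) by blast
    then obtain i where i: "i \<in> W" "x = g i" using im by (auto simp: B_def)
    have "\<sigma> (g i) \<noteq> g i" using x A(3) i(2) by force
    then have "i \<notin> dom (label F)" by (simp add: F_def dom_def)
    then show ?thesis using i(1) by (auto simp: F_def)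
  qed
  ultimately show ?thesis
    using F unfolding nontrivial_square_def trivial_square_def fully_labeled_copy_def by blast
qed

text \<open>
  The exchange of \<open>a\<close> and \<open>b\<close> acts on the new vertices by direct image, as these are unordered pairs.
  It fixes the pair \<open>{a, b}\<close>, which therefore belongs to neither half, so that \<open>a\<close> and \<open>b\<close> may be
  adjacent in \<open>G\<close>.
\<close>

lemma nontrivial_square_div_graph_if_twins:
  assumes G: "pair_graph G" and ab: "a \<in> pverts G" "b \<in> pverts G" "a \<noteq> b"
    and twins: "\<And>u v. (u, v) \<in> parcs G \<Longrightarrow> (transpose a b u, transpose a b v) \<in> parcs G"
  shows "nontrivial_square (div_graph G)"
proof -
  interpret G: pair_graph G by fact
  define \<tau> where "\<tau> = transpose a b"
  define \<sigma> where "\<sigma> = map_sum \<tau> ((`) \<tau>)"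
  define A where "A = insert (Inl a) {Inr {a, c} | c. (a, c) \<in> parcs G \<and> c \<noteq> b}"
  have \<tau>: "\<tau> (\<tau> u) = u" "\<tau> a = b" "\<tau> b = a" for u by (simp_all add: \<tau>_def)
  have \<tau>_other: "\<tau> c = c" if "c \<noteq> a" "c \<noteq> b" for c using that by (simp add: \<tau>_def)
  have \<tau>_arc: "(\<tau> u, \<tau> v) \<in> parcs G" if "(u, v) \<in> parcs G" for u v
    using twins[OF that] by (simp add: \<tau>_def)
  have \<tau>_vert: "\<tau> u \<in> pverts G" if "u \<in> pverts G" for u
    using that ab by (cases "u = a \<or> u = b") (auto simp: \<tau> \<tau>_other)
  have sym: "(v, u) \<in> parcs G" if "(u, v) \<in> parcs G" for u v
    using that G.arcs_symmetric by (auto simp: sym_def)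
  have \<sigma>: "\<sigma> (Inl u) = Inl (\<tau> u)" "\<sigma> (Inr {u, v}) = Inr {\<tau> u, \<tau> v}" for u v
    by (simp_all add: \<sigma>_def)
  have A_Inl: "Inl u \<in> A \<longleftrightarrow> u = a" for u by (auto simp: A_def)
  have A_Inr: "Inr {u, v} \<in> A \<longleftrightarrow> (u = a \<and> v \<noteq> b \<or> v = a \<and> u \<noteq> b)" if "(u, v) \<in> parcs G" for u v
    using that sym[OF that] by (auto simp: A_def doubleton_eq_iff)
  show ?thesis
  proof (rule nontrivial_square_if_mirror[where \<sigma> = \<sigma> and A = A])
    show "pair_graph (div_graph G)" by (rule pair_graph_div_graph[OF G])
  next
    fix x assume x: "x \<in> pverts (div_graph G)"
    then consider u where "x = Inl u" "u \<in> pverts G"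
      | u v where "x = Inr {u, v}" "(u, v) \<in> parcs G"
      by (auto simp: div_graph_def)
    note cases = this
    show "\<sigma> x \<in> pverts (div_graph G)"
      using cases by cases (auto simp: \<sigma> div_graph_def \<tau>_vert dest: \<tau>_arc)
    show "\<sigma> (\<sigma> x) = x" using cases by cases (simp_all add: \<sigma> \<tau>)
    show "\<sigma> x = x \<or> x \<in> A \<or> \<sigma> x \<in> A"
      using cases
    proof cases
      case 1 then show ?thesis using \<tau> \<tau>_other[of u] by (auto simp: \<sigma> A_Inl)
    next
      case 2
      have "u \<noteq> v" using 2(2) by (rule G.no_loops')
      then show ?thesis
        using 2 \<tau> \<tau>_other[of u] \<tau>_other[of v] \<tau>_arc[OF 2(2)]
        by (cases "u = a"; cases "u = b"; cases "v = a"; cases "v = b")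
          (auto simp: \<sigma> A_Inr doubleton_eq_iff)
    qed
  next
    fix x y assume "(x, y) \<in> parcs (div_graph G)"
    then obtain u v where uv: "(u, v) \<in> parcs G"
      and xy: "x = Inl u \<and> y = Inr {u, v} \<or> x = Inr {u, v} \<and> y = Inl u"
      by (auto simp: div_graph_def)
    show "(\<sigma> x, \<sigma> y) \<in> parcs (div_graph G)"
      using xy \<tau>_arc[OF uv] by (auto simp: \<sigma> div_graph_def)
    have "u \<noteq> v" using uv by (rule G.no_loops')
    then show "\<sigma> y \<notin> A" if "x \<in> A"
      using that xy uv ab(3) \<tau> \<tau>_other[of u] \<tau>_other[of v] \<tau>_arc[OF uv]
      by (cases "u = a"; cases "u = b"; cases "v = a"; cases "v = b")
        (auto simp: \<sigma> A_Inl A_Inr)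
  next
    show "A \<subseteq> pverts (div_graph G)" using ab by (auto simp: A_def div_graph_def)
    show "A \<noteq> {}" by (simp add: A_def)
    have "\<sigma> x \<notin> A" if x: "x \<in> A" for x
    proof -
      consider "x = Inl a" | c where "x = Inr {a, c}" "(a, c) \<in> parcs G" "c \<noteq> b"
        using x by (auto simp: A_def)
      then show ?thesis
      proof cases
        case 1 then show ?thesis using ab by (simp add: \<sigma> \<tau> A_Inl)
      next
        case 2
        have "c \<noteq> a" using G.no_loops'[OF 2(2)] by simp
        then show ?thesis using 2 ab \<tau>_arc[OF 2(2)] by (simp add: \<sigma> \<tau> \<tau>_other A_Inr)
      qed
    qed
    then show "A \<inter> \<sigma> ` A = {}" by blast
  qed
qed

theorem lemma2p6:
  fixes k :: nat and G :: "'a pair_pre_digraph"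
  assumes "k \<ge> 2" and "K\<^bsub>k\<^esub> (with_proj G)"
  shows "nontrivial_square (div_graph G)"
proof -
  have card: "card (pverts G) = k"
    and arcs: "parcs G = {(u, v). (u, v) \<in> pverts G \<times> pverts G \<and> u \<noteq> v}"
    using assms(2) unfolding complete_digraph_pair_def by blast+
  have "\<exists>T \<subseteq> pverts G. card T = 2" using card assms(1) by (metis obtain_subset_with_card_n)
  then obtain a b where ab: "a \<in> pverts G" "b \<in> pverts G" "a \<noteq> b"
    by (auto simp: card_2_iff)
  have "pair_graph G" using assms(2) by (rule pair_graphI_complete)
  then show ?thesis
    by (rule nontrivial_square_div_graph_if_twins[OF _ ab])
      (auto simp: arcs ab transpose_def)
qed

end
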